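(* WSR-MM+ for MISO beamforming is a projected gradient ascent step. Precisely: let $\{\underline{\mathbf{w}}_i\}\in\mathcal{W}$, $\mathbf{S}=\sum_{j=1}^{K}\omega_j a_j\mathbf{h}_j\mathbf{h}_j^{\mathsf{H}}$, let $\eta>0$ with $\eta\ge\lambda_{\max}(\mathbf{S})$, and let $$\mathbf{q}_k=\eta^{-1}\Bigl(\omega_k b_k^{*}\mathbf{h}_k-(\mathbf{S}-\eta\mathbf{I})\underline{\mathbf{w}}_k\Bigr),\qquad k=1,\dots,K.$$ Then $$\mathbf{q}_k=\underline{\mathbf{w}}_k+\frac{1}{2\eta}\frac{\partial f(\{\underline{\mathbf{w}}_i\})}{\partial\mathbf{w}_k},\qquad k=1,\dots,K,$$ and hence the WSR-MM+ update, i.e. the minimizer of $\sum_{k=1}^{K}\eta\|\mathbf{w}_k-\mathbf{q}_k\|^2$ over $\{\mathbf{w}_i\}\in\mathcal{W}$, equals the projected gradient ascent step $\mathrm{Proj}_{\mathcal{W}}\bigl(\{\underline{\mathbf{w}}_k+\frac{1}{2\eta}\frac{\partial f(\{\underline{\mathbf{w}}_i\})}{\partial\mathbf{w}_k}\}_{k=1}^{K}\bigr)$ with step size $\frac{1}{2\eta}$.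
   Context: Setting: $K$ users; channels $\mathbf{h}_k\in\mathbb{C}^M$, beamformers $\mathbf{w}_k\in\mathbb{C}^M$, noise variances $\sigma_k^2>0$, weights $\omega_k>0$, power budget $P>0$. $\mathsf{SINR}_k=\dfrac{|\mathbf{h}_k^{\mathsf{H}}\mathbf{w}_k|^2}{\sum_{j\ne k}|\mathbf{h}_k^{\mathsf{H}}\mathbf{w}_j|^2+\sigma_k^2}$, $f(\{\mathbf{w}_i\})=\sum_{k=1}^{K}\omega_k\log(1+\mathsf{SINR}_k)$ (natural logarithm), $\mathcal{W}=\{\{\mathbf{w}_i\}:\sum_{k=1}^{K}\|\mathbf{w}_k\|^2\le P\}$; $\mathrm{Proj}_{\mathcal{W}}$ is the Euclidean projection onto $\mathcal{W}$. With $\underline{\mathsf{SINR}}_k$ denoting $\mathsf{SINR}_k$ at $\{\underline{\mathbf{w}}_i\}$: $a_k=\dfrac{\underline{\mathsf{SINR}}_k}{\sum_{j=1}^{K}|\mathbf{h}_k^{\mathsf{H}}\underline{\mathbf{w}}_j|^2+\sigma_k^2}$ and $b_k=\dfrac{(\mathbf{h}_k^{\mathsf{H}}\underline{\mathbf{w}}_k)^*}{\sum_{j\ne k}|\mathbf{h}_k^{\mathsf{H}}\underline{\mathbf{w}}_j|^2+\sigma_k^2}$ (which equals $\underline{\mathsf{SINR}}_k/(\mathbf{h}_k^{\mathsf{H}}\underline{\mathbf{w}}_k)$ when $\mathbf{h}_k^{\mathsf{H}}\underline{\mathbf{w}}_k\ne0$). Gradient convention: $\partial f/\partial\mathbf{w}_k$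 is the vector $\mathbf{g}_k\in\mathbb{C}^M$ such that the first-order variation of $f$ in direction $\boldsymbol{\delta}$ of the block $\mathbf{w}_k$ is $\mathrm{Re}(\mathbf{g}_k^{\mathsf{H}}\boldsymbol{\delta})$ (i.e. twice the Wirtinger derivative with respect to the conjugate of $\mathbf{w}_k$). *)

theory Defs
  imports "HOL-Analysis.Analysis"
begin

text \<open>
  Users are indexed by a finite type \<open>'k\<close> and antennas by a finite type \<open>'m\<close>, so that
  \<open>K = CARD('k)\<close> and \<open>M = CARD('m)\<close>.  A beamformer tuple is an element of \<open>complex ^ 'm ^ 'k\<close>,
  whose library norm satisfies \<open>(norm w)\<^sup>2 = (\<Sum>k\<in>UNIV. (norm (w $ k))\<^sup>2)\<close>; the distance used
  by \<open>closest_point\<close> is therefore the Euclidean distance between tuples.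
\<close>

definition hprod :: "complex ^ 'm::finite \<Rightarrow> complex ^ 'm \<Rightarrow> complex" where
  "hprod x y = (\<Sum>i\<in>UNIV. cnj (x $ i) * y $ i)"

definition houter :: "complex ^ 'm::finite \<Rightarrow> complex ^ 'm \<Rightarrow> complex ^ 'm ^ 'm" where
  "houter x y = (\<chi> i j. x $ i * cnj (y $ j))"

text \<open>Only meaningful for Hermitian matrices: only real eigenvalues are taken into account.\<close>

definition lambda_max :: "complex ^ 'm ^ 'm::finite \<Rightarrow> real" where
  "lambda_max A = Max {l. \<exists>v. v \<noteq> 0 \<and> A *v v = complex_of_real l *s v}"

definition interference_noise ::
    "('k::finite \<Rightarrow> complex ^ 'm::finite) \<Rightarrow> ('k \<Rightarrow> real) \<Rightarrow> complex ^ 'm ^ 'k \<Rightarrow> 'k \<Rightarrow> real" where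
  "interference_noise h \<sigma> w k = (\<Sum>j\<in>UNIV - {k}. (cmod (hprod (h k) (w $ j)))\<^sup>2) + (\<sigma> k)\<^sup>2"

definition SINR ::
    "('k::finite \<Rightarrow> complex ^ 'm::finite) \<Rightarrow> ('k \<Rightarrow> real) \<Rightarrow> complex ^ 'm ^ 'k \<Rightarrow> 'k \<Rightarrow> real" where
  "SINR h \<sigma> w k = (cmod (hprod (h k) (w $ k)))\<^sup>2 / interference_noise h \<sigma> w k"

definition weighted_sum_rate ::
    "('k::finite \<Rightarrow> complex ^ 'm::finite) \<Rightarrow> ('k \<Rightarrow> real) \<Rightarrow> ('k \<Rightarrow> real) \<Rightarrow> complex ^ 'm ^ 'k \<Rightarrow> real"
  where
  "weighted_sum_rate h \<sigma> \<omega> w = (\<Sum>k\<in>UNIV. \<omega> k * ln (1 + SINR h \<sigma> w k))"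

definition power_set :: "real \<Rightarrow> (complex ^ 'm::finite ^ 'k::finite) set" where
  "power_set P = {w. (\<Sum>k\<in>UNIV. (norm (w $ k))\<^sup>2) \<le> P}"

definition coeff_a ::
    "('k::finite \<Rightarrow> complex ^ 'm::finite) \<Rightarrow> ('k \<Rightarrow> real) \<Rightarrow> complex ^ 'm ^ 'k \<Rightarrow> 'k \<Rightarrow> real" where
  "coeff_a h \<sigma> w k =
     SINR h \<sigma> w k / ((\<Sum>j\<in>UNIV. (cmod (hprod (h k) (w $ j)))\<^sup>2) + (\<sigma> k)\<^sup>2)"

definition coeff_b ::
    "('k::finite \<Rightarrow> complex ^ 'm::finite) \<Rightarrow> ('k \<Rightarrow> real) \<Rightarrow> complex ^ 'm ^ 'k \<Rightarrow> 'k \<Rightarrow> complex" where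
  "coeff_b h \<sigma> w k =
     cnj (hprod (h k) (w $ k)) / complex_of_real (interference_noise h \<sigma> w k)"

definition update_block :: "'a ^ 'k::finite \<Rightarrow> 'k \<Rightarrow> 'a \<Rightarrow> 'a ^ 'k" where
  "update_block w k v = (\<chi> i. if i = k then v else w $ i)"

text \<open>
  The gradient with respect to one block, normalised so that the first-order variation in
  direction \<open>d\<close> is \<open>Re (hprod g d)\<close>, i.e. \<open>g\<close> is twice the Wirtinger derivative with respect
  to the conjugate of the block.
\<close>

definition has_block_gradient ::
    "(complex ^ 'm::finite ^ 'k::finite \<Rightarrow> real) \<Rightarrow> complex ^ 'm \<Rightarrow> complex ^ 'm ^ 'k \<Rightarrow> 'k \<Rightarrow> bool"
  where
  "has_block_gradient f g w k \<longleftrightarrow>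
     ((\<lambda>v. f (update_block w k v)) has_derivative (\<lambda>d. Re (hprod g d))) (at (w $ k))"

definition block_gradient ::
    "(complex ^ 'm::finite ^ 'k::finite \<Rightarrow> real) \<Rightarrow> complex ^ 'm ^ 'k \<Rightarrow> 'k \<Rightarrow> complex ^ 'm" where
  "block_gradient f w k = (THE g. has_block_gradient f g w k)"

end

(* Write T_j for the total received power plus noise at user j and I_j for its interference plus
   noise, so that the rate is the sum of \<omega>_j (ln T_j - ln I_j).  Only the summand |h_j^H w_k|^2
   depends on block k; it occurs in T_j for all j and in I_j for j \<noteq> k.  Since
   1 / T_j - 1 / I_j = - a_j, the surplus 1 / I_k in the k-th summand gives b_k, and the gradient
   is 2 (\<omega>_k b_k^* h_k - S w_k). *)
theory Submission
  imports Defs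
begin

lemma hprod_add_right: "hprod x (y + z) = hprod x y + hprod x z"
  by (simp add: hprod_def distrib_left sum.distrib)

lemma hprod_scaleR_right: "hprod x (r *\<^sub>R y) = r *\<^sub>R hprod x y"
  by (simp add: hprod_def scaleR_sum_right)

lemma linear_hprod: "linear (hprod x)"
  by (intro linearI hprod_add_right hprod_scaleR_right)

lemma hprod_diff_left: "hprod (x - y) z = hprod x z - hprod y z"
  by (simp add: hprod_def left_diff_distrib sum_subtractf)

lemma hprod_scaleR_left: "hprod (r *\<^sub>R x) y = r *\<^sub>R hprod x y"
  by (simp add: hprod_def scaleR_sum_right)

lemma hprod_vector_scalar_left: "hprod (c *s x) y = cnj c * hprod x y"
  by (simp add: hprod_def sum_distrib_left mult.assoc)

lemma hprod_sum_left: "hprod (\<Sum>a\<in>A. f a) y = (\<Sum>a\<in>A. hprod (f a) y)"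
  unfolding hprod_def by (simp add: sum_distrib_right) (rule sum.swap)

text \<open>Ties the gradient convention to the real inner product of the library, which makes
  gradients unique.\<close>

lemma Re_hprod: "Re (hprod x y) = x \<bullet> y"
  by (simp add: hprod_def inner_vec_def inner_complex_def)

text \<open>Turns \<open>S *v (w $ k)\<close> into a combination of the channels \<open>h j\<close>,
  to be compared with the derivative term by term.\<close>

lemma houter_mult_vec: "houter x y *v v = hprod y v *s x"
  by (simp add: vec_eq_iff houter_def hprod_def matrix_vector_mult_def sum_distrib_left mult_ac)

lemma scaleR_matrix_vec_mult: "(r *\<^sub>R A) *v v = r *\<^sub>R (A *v v)"
  for A :: "complex ^ 'n ^ 'm"
  by (simp add: vec_eq_iff matrix_vector_mult_def scaleR_sum_right)

lemma sum_matrix_vec_mult: "(\<Sum>a\<in>A. f a) *v v = (\<Sum>a\<in>A. f a *v v)"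
  for f :: "'a \<Rightarrow> complex ^ 'n ^ 'm"
  by (simp add: vec_eq_iff matrix_vector_mult_def sum_distrib_right) (auto intro: sum.swap)

text \<open>A Frechet derivative is unique, and a vector is determined by its real inner products
  with all \<open>d\<close>; hence the \<open>THE\<close> is well defined.\<close>

lemma block_gradient_eq:
  assumes "has_block_gradient f g w k"
  shows "block_gradient f w k = g"
  unfolding block_gradient_def
proof (rule the_equality[of "\<lambda>g. has_block_gradient f g w k", OF assms])
  fix g' assume "has_block_gradient f g' w k"
  with assms have "(\<lambda>d. Re (hprod g' d)) = (\<lambda>d. Re (hprod g d))"
    unfolding has_block_gradient_def by (rule has_derivative_unique[rotated])
  then have "\<And>d. g' \<bullet> d = g \<bullet> d"
    unfolding Re_hprod by meson
  then show "g' = g"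
    by (metis vector_eq_rdot)
qed

lemma update_block_same [simp]: "update_block w k (w $ k) = w"
  by (simp add: update_block_def vec_eq_iff)

text \<open>The index set \<open>A\<close> stays general to serve both \<open>received_power\<close>
  (all users) and \<open>interference_noise\<close> of user \<open>j\<close> (all but
  \<open>j\<close>); the block \<open>k\<close> contributes exactly when it lies in
  \<open>A\<close>.\<close>

lemma has_derivative_sum_norm_hprod_update_block:
  assumes "finite A"
  shows "((\<lambda>v. \<Sum>i\<in>A. (cmod (hprod x (update_block w k v $ i)))\<^sup>2) has_derivative
          (\<lambda>d. of_bool (k \<in> A) * (2 * (hprod x (w $ k) \<bullet> hprod x d)))) (at (w $ k))"
proof -
  have der: "(hprod x has_derivative hprod x) F" for F
    by (rule linear_imp_has_derivative[OF linear_hprod])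
  have summand: "((\<lambda>v. (cmod (hprod x (update_block w k v $ i)))\<^sup>2) has_derivative
         (\<lambda>d. if i = k then 2 * (hprod x (w $ k) \<bullet> hprod x d) else 0)) (at (w $ k))" for i
  proof (cases "i = k")
    case True
    show ?thesis
      \<comment> \<open>As an inner product of \<open>hprod x v\<close> with itself, the square
        falls under the product rule, whose two terms agree by symmetry; hence the factor 2.\<close>
      unfolding update_block_def power2_norm_eq_inner
      by (rule has_derivative_eq_rhs, simp add: True, rule has_derivative_inner[OF der der])
         (simp add: True inner_commute)
  qed (simp add: update_block_def)
  show ?thesis
    by (rule has_derivative_eq_rhs[OF has_derivative_sum[OF summand]])
       (use assms in \<open>auto simp: fun_eq_iff\<close>)
qed

text \<open>The total power T_k of the overview, which is also the denominator in
  \<open>coeff_a\<close>.\<close>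

definition received_power ::
    "('k::finite \<Rightarrow> complex ^ 'm::finite) \<Rightarrow> ('k \<Rightarrow> real) \<Rightarrow> complex ^ 'm ^ 'k \<Rightarrow> 'k \<Rightarrow> real" where
  "received_power h \<sigma> w k = (\<Sum>j\<in>UNIV. (cmod (hprod (h k) (w $ j)))\<^sup>2) + (\<sigma> k)\<^sup>2"

lemma received_power_eq:
  "received_power h \<sigma> w k = (cmod (hprod (h k) (w $ k)))\<^sup>2 + interference_noise h \<sigma> w k"
  by (simp add: received_power_def interference_noise_def sum.remove[of UNIV k])

lemma interference_noise_pos:
  assumes "\<sigma> k \<noteq> 0"
  shows "interference_noise h \<sigma> w k > 0"
  unfolding interference_noise_def using assms by (intro add_nonneg_pos sum_nonneg) auto

lemma received_power_pos:
  assumes "\<sigma> k \<noteq> 0"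
  shows "received_power h \<sigma> w k > 0"
  unfolding received_power_def using assms by (intro add_nonneg_pos sum_nonneg) auto

text \<open>1 + SINR is the quotient of total power by interference plus noise; both are positive,
  so the logarithm splits and no quotient has to be differentiated.\<close>

lemma weighted_sum_rate_eq:
  assumes "\<And>k. \<sigma> k \<noteq> 0"
  shows "weighted_sum_rate h \<sigma> \<omega> w =
    (\<Sum>k\<in>UNIV. \<omega> k * (ln (received_power h \<sigma> w k) - ln (interference_noise h \<sigma> w k)))"
proof -
  have "1 + SINR h \<sigma> w k = received_power h \<sigma> w k / interference_noise h \<sigma> w k" for k
    using interference_noise_pos[of \<sigma> k h w, OF assms]
    by (simp add: SINR_def received_power_eq add_divide_distrib)
  then show ?thesis
    unfolding weighted_sum_rate_def
    by (simp add: ln_divide_pos interference_noise_pos received_power_pos assms)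
qed

text \<open>The signal power is the difference T - I, so SINR / T = (T - I) / (I T), which separates
  into partial fractions.\<close>

lemma coeff_a_eq:
  assumes "\<sigma> k \<noteq> 0"
  shows "coeff_a h \<sigma> w k =
    inverse (interference_noise h \<sigma> w k) - inverse (received_power h \<sigma> w k)"
proof -
  have pos: "interference_noise h \<sigma> w k > 0" "received_power h \<sigma> w k > 0"
    using assms by (simp_all add: interference_noise_pos received_power_pos)
  have "coeff_a h \<sigma> w k =
      (received_power h \<sigma> w k - interference_noise h \<sigma> w k) / interference_noise h \<sigma> w k
        / received_power h \<sigma> w k"
    by (simp add: coeff_a_def SINR_def received_power_eq flip: received_power_def)
  also have "\<dots> = inverse (interference_noise h \<sigma> w k) - inverse (received_power h \<sigma> w k)"
    using pos by (simp add: diff_divide_distrib inverse_eq_divide)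
  finally show ?thesis .
qed

lemma has_block_gradient_weighted_sum_rate:
  fixes h :: "'k::finite \<Rightarrow> complex ^ 'm::finite"
  assumes nz: "\<And>k. \<sigma> k \<noteq> 0"
  shows "has_block_gradient (weighted_sum_rate h \<sigma> \<omega>)
    (2 *\<^sub>R ((complex_of_real (\<omega> k) * cnj (coeff_b h \<sigma> w k)) *s h k
      - (\<Sum>j\<in>UNIV. (\<omega> j * coeff_a h \<sigma> w j) *\<^sub>R houter (h j) (h j)) *v (w $ k))) w k"
  (is "has_block_gradient _ ?g w k")
proof -
  \<comment> \<open>The derivative of the power that user \<open>j\<close> receives from block
    \<open>k\<close>, shared by T_j and I_j.\<close>
  define D where "D j d = 2 * (hprod (h j) (w $ k) \<bullet> hprod (h j) d)" for j d
  have derT: "((\<lambda>v. received_power h \<sigma> (update_block w k v) j) has_derivative D j) (at (w $ k))"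
    for j
    unfolding received_power_def D_def
    by (rule has_derivative_eq_rhs[OF has_derivative_add[OF
          has_derivative_sum_norm_hprod_update_block has_derivative_const]]) auto
  have derI: "((\<lambda>v. interference_noise h \<sigma> (update_block w k v) j) has_derivative
      (\<lambda>d. of_bool (k \<noteq> j) * D j d)) (at (w $ k))" for j
    unfolding interference_noise_def D_def
    by (rule has_derivative_eq_rhs[OF has_derivative_add[OF
          has_derivative_sum_norm_hprod_update_block has_derivative_const]]) auto
  have "((\<lambda>v. weighted_sum_rate h \<sigma> \<omega> (update_block w k v)) has_derivative
      (\<lambda>d. \<Sum>j\<in>UNIV. \<omega> j * (D j d * inverse (received_power h \<sigma> w j)
         - of_bool (k \<noteq> j) * D j d * inverse (interference_noise h \<sigma> w j)))) (at (w $ k))"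
    unfolding weighted_sum_rate_eq[OF nz]
    by (rule has_derivative_eq_rhs, rule has_derivative_sum, rule has_derivative_mult_right,
        rule has_derivative_diff[OF has_derivative_ln[OF _ derT] has_derivative_ln[OF _ derI]])
       (auto simp: received_power_pos interference_noise_pos nz)
  also have "(\<lambda>d. \<Sum>j\<in>UNIV. \<omega> j * (D j d * inverse (received_power h \<sigma> w j)
         - of_bool (k \<noteq> j) * D j d * inverse (interference_noise h \<sigma> w j))) =
      (\<lambda>d. Re (hprod ?g d))"
  proof
    fix d
    \<comment> \<open>For j \<noteq> k the factor 1/T_j - 1/I_j is -a_j; for j = k the lone 1/T_k is
      1/I_k - a_k. Splitting off 1/I_k lets the sum of the -a_j terms run over all users, as in
      \<open>S\<close>.\<close>
    have "(\<Sum>j\<in>UNIV. \<omega> j * (D j d * inverse (received_power h \<sigma> w j)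
         - of_bool (k \<noteq> j) * D j d * inverse (interference_noise h \<sigma> w j))) =
        (\<Sum>j\<in>UNIV. of_bool (k = j) * (\<omega> j * D j d * inverse (interference_noise h \<sigma> w j))
         - \<omega> j * coeff_a h \<sigma> w j * D j d)"
      by (intro sum.cong refl) (simp add: coeff_a_eq[OF nz] algebra_simps)
    also have "\<dots> = \<omega> k * D k d * inverse (interference_noise h \<sigma> w k)
         - (\<Sum>j\<in>UNIV. \<omega> j * coeff_a h \<sigma> w j * D j d)"
      by (simp add: sum_subtractf of_bool_def if_distrib[of "\<lambda>c. c * _"] cong: if_cong)
    also have "\<dots> = Re (hprod ?g d)"
    proof -
      have D: "D j d = 2 * Re (cnj (hprod (h j) (w $ k)) * hprod (h j) d)" for j
        by (simp add: D_def inner_complex_def)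
      \<comment> \<open>The denominator I_k is real, so it can be moved inside \<open>Re\<close>,
        where it joins the conjugated signal to form \<open>coeff_b\<close>.\<close>
      have b: "\<omega> k * D k d * inverse (interference_noise h \<sigma> w k) =
          2 * Re (complex_of_real (\<omega> k) * coeff_b h \<sigma> w k * hprod (h k) d)"
        by (simp add: D coeff_b_def divide_inverse algebra_simps flip: of_real_inverse)
      \<comment> \<open>\<open>hprod\<close> conjugates its first argument: the
        \<open>cnj (coeff_b ...)\<close> in the gradient becomes \<open>coeff_b\<close>, and the
        coefficients of \<open>S *v (w $ k)\<close> become the conjugates occurring in
        \<open>D\<close>.\<close>
      show ?thesis
        unfolding b
        by (simp add: D hprod_scaleR_left hprod_diff_left hprod_vector_scalar_left
            hprod_sum_left sum_matrix_vec_mult scaleR_matrix_vec_mult houter_mult_vec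
            sum_distrib_left algebra_simps)
    qed
    finally show "(\<Sum>j\<in>UNIV. \<omega> j * (D j d * inverse (received_power h \<sigma> w j)
         - of_bool (k \<noteq> j) * D j d * inverse (interference_noise h \<sigma> w j))) = Re (hprod ?g d)" .
  qed
  finally show ?thesis
    unfolding has_block_gradient_def .
qed

lemma norm_vec_power2: "(norm w)\<^sup>2 = (\<Sum>k\<in>UNIV. (norm (w $ k))\<^sup>2)"
  by (simp add: norm_vec_def L2_set_def sum_nonneg)

text \<open>The power constraint bounds the squared norm of the whole tuple. As a ball, the feasible
  set is visibly closed and convex.\<close>

lemma power_set_eq_cball: "(power_set P :: (complex ^ 'm::finite ^ 'k::finite) set) = cball 0 (sqrt P)"
proof -
  have "(norm w)\<^sup>2 \<le> P \<longleftrightarrow> norm w \<le> sqrt P" for w :: "complex ^ 'm ^ 'k"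
    using real_sqrt_le_iff[of "(norm w)\<^sup>2" P] by simp
  then show ?thesis
    by (simp add: power_set_def set_eq_iff flip: norm_vec_power2)
qed

text \<open>Squaring and scaling by \<eta> > 0 preserve the order of distances, so minimizers are
  nearest points; a nonempty closed convex set has exactly one.\<close>

lemma is_arg_min_norm_power2_iff_closest_point:
  fixes W :: "'a::euclidean_space set"
  assumes "convex W" "closed W" "W \<noteq> {}" "\<eta> > 0"
  shows "is_arg_min (\<lambda>v. \<eta> * (norm (v - q))\<^sup>2) (\<lambda>v. v \<in> W) w \<longleftrightarrow> w = closest_point W q"
proof -
  have "is_arg_min (\<lambda>v. \<eta> * (norm (v - q))\<^sup>2) (\<lambda>v. v \<in> W) w \<longleftrightarrow>
      w \<in> W \<and> (\<forall>v\<in>W. dist q w \<le> dist q v)"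
    using \<open>\<eta> > 0\<close> by (auto simp: is_arg_min_linorder dist_norm norm_minus_commute)
  also have "\<dots> \<longleftrightarrow> w = closest_point W q"
    using closest_point_unique[OF assms(1,2)] closest_point_exists[OF assms(2,3)] by blast
  finally show ?thesis .
qed

theorem mainTheorem10:
  fixes h :: "'k::finite \<Rightarrow> complex ^ 'm::finite"
    and \<sigma> \<omega> :: "'k \<Rightarrow> real"
    and P \<eta> :: real
    and w0 :: "complex ^ 'm ^ 'k"
    and S :: "complex ^ 'm ^ 'm"
    and q :: "complex ^ 'm ^ 'k"
  assumes "\<And>k. (\<sigma> k)\<^sup>2 > 0"
    and "\<And>k. \<omega> k > 0"
    and "P > 0"
    and "w0 \<in> power_set P"
    and "S = (\<Sum>j\<in>UNIV. (\<omega> j * coeff_a h \<sigma> w0 j) *\<^sub>R houter (h j) (h j))"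
    and "\<eta> > 0"
    and "\<eta> \<ge> lambda_max S"
    and "\<And>k. q $ k = inverse \<eta> *\<^sub>R
            ((complex_of_real (\<omega> k) * cnj (coeff_b h \<sigma> w0 k)) *s h k
              - (S - \<eta> *\<^sub>R mat 1) *v (w0 $ k))"
  shows "(\<forall>k. has_block_gradient (weighted_sum_rate h \<sigma> \<omega>)
                (block_gradient (weighted_sum_rate h \<sigma> \<omega>) w0 k) w0 k)
       \<and> (\<forall>k. q $ k = w0 $ k + (1 / (2 * \<eta>)) *\<^sub>R block_gradient (weighted_sum_rate h \<sigma> \<omega>) w0 k)
       \<and> (\<forall>w. is_arg_min (\<lambda>v. \<Sum>k\<in>UNIV. \<eta> * (norm (v $ k - q $ k))\<^sup>2) (\<lambda>v. v \<in> power_set P) w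
              \<longleftrightarrow> w = closest_point (power_set P)
                    (\<chi> k. w0 $ k + (1 / (2 * \<eta>)) *\<^sub>R block_gradient (weighted_sum_rate h \<sigma> \<omega>) w0 k))"
proof -
  let ?f = "weighted_sum_rate h \<sigma> \<omega>"
  let ?W = "power_set P :: (complex ^ 'm ^ 'k) set"
  define g where "g k = 2 *\<^sub>R ((complex_of_real (\<omega> k) * cnj (coeff_b h \<sigma> w0 k)) *s h k
    - S *v (w0 $ k))" for k
  have grad: "has_block_gradient ?f (g k) w0 k" for k
    unfolding g_def assms(5) using assms(1) by (simp add: has_block_gradient_weighted_sum_rate)
  have grad_eq: "block_gradient ?f w0 k = g k" for k
    by (rule block_gradient_eq[OF grad])
  have q_eq: "q $ k = w0 $ k + (1 / (2 * \<eta>)) *\<^sub>R g k" for k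
  proof -
    \<comment> \<open>The shift by \<eta> times the identity restores \<open>w0 $ k\<close> after
      division by \<eta>; the step size 1/(2 \<eta>) absorbs the factor 2 in
      \<open>g\<close>.\<close>
    have "(S - \<eta> *\<^sub>R mat 1) *v (w0 $ k) = S *v (w0 $ k) - \<eta> *\<^sub>R (w0 $ k)"
      by (simp add: matrix_vector_mult_diff_rdistrib scaleR_matrix_vec_mult)
    then show ?thesis
      using \<open>\<eta> > 0\<close> unfolding assms(8) g_def by (simp add: scaleR_diff_right inverse_eq_divide)
  qed
  have W: "convex ?W" "closed ?W" "?W \<noteq> {}"
    using \<open>P > 0\<close> by (simp_all add: power_set_eq_cball)
  \<comment> \<open>The blockwise costs add up to one squared tuple distance, so the update is
    itself a projection of \<open>q\<close>.\<close>
  have cost: "(\<Sum>k\<in>UNIV. \<eta> * (norm (v $ k - q $ k))\<^sup>2) = \<eta> * (norm (v - q))\<^sup>2" for v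
    by (simp add: norm_vec_power2 sum_distrib_left)
  have target: "(\<chi> k. w0 $ k + (1 / (2 * \<eta>)) *\<^sub>R g k) = q"
    by (simp add: vec_eq_iff q_eq)
  show ?thesis
    unfolding grad_eq target cost
    using grad q_eq is_arg_min_norm_power2_iff_closest_point[OF W \<open>\<eta> > 0\<close>] by blast
qed

end
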